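(* Let $C$ be a set. A skew monoidale in the monoidal bicategory $\mathrm{Span}$ with underlying object $C$ amounts to a category $\mathbb C$ with object set $C$ together with (a) a functor $R\colon \mathrm{Dec}(\mathbb C)\to\mathbb C$, such that (b) the following square of functors commutes: $R\circ \mathrm{Dec}(\mathrm{Cod}) = R\circ \mathrm{Dec}(R)\colon \mathrm{Dec}(\mathrm{Dec}(\mathbb C))\to\mathbb C$; and (c) for every object $x$ of $\mathbb C$, if $x=R(1_x)$ then $R_x=\mathrm{Cod}_x$, where $R_x$ denotes the restriction of $R$ to the summand $(x\downarrow\mathbb C)$ of $\mathrm{Dec}(\mathbb C)$. Precisely: (i) Given a skew monoidal structure $(p,j,\alpha,\lambda,\rho)$ on $C$ in $\mathrm{Span}$, with tensor product $p=\big(C\times C\xleftarrow{(s,r)}E\xrightarrow{t}C\big)$ and unit $j=\big(1\xleftarrow{!}U\xrightarrow{j}C\big)$, and with $\alpha(f,g)=(g^f,gf)$ and $\rho(x)=(\psi_x,\phi_x)$ (see the context for this notation), there is a category $\mathbb C$ with object set $C$, arrow set $E$, source $s$, target $t$, composition $(f,g)\mapsto gf$ and identities $1_x=\phi_x$. Moreover, the assignments $R(f)=r(f)$ on objects $f\in E$ of $\mathrm{Dec}(\mathbb C)$ and $R\big(g\colon f\to gf\big)=\big(g^f\colon r(f)\to r(gf)\big)$ on arrows define a functor $R\colon\mathrm{Dec}(\mathbb C)\to\mathbb C$ satisfying (b) and (c). (ii) Conversely, every pair $(\mathbb C,R)$ consisting of a category $\mathbb C$ with object set $C$ and a functor $R\colon\mathrm{Dec}(\mathbb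 C)\to\mathbb C$ satisfying (b) and (c) arises as in (i) from a skew monoidal structure on $C$ in $\mathrm{Span}$. This structure is unique up to replacing the unit span $U\xrightarrow{j}C$ by an isomorphic one over $C$ (with the structure 2-cells transported along the isomorphism). The data $U$, $j\colon U\to C$, $\psi\colon C\to U$ form a splitting ($\psi j=1_U$, $j\psi=e$) of the idempotent function $e\colon C\to C$, $e(x)=R(1_x)$.
   Context: **Span.** $\mathrm{Span}$ is the bicategory whose objects are sets, whose arrows $A\to B$ are spans $A\xleftarrow{f}R\xrightarrow{g}B$ of functions, composed by pullback (using the standard pullbacks in sets), and whose 2-cells are functions between the apexes commuting with both legs. The cartesian product of sets makes it a monoidal bicategory, with unit object the one-point set $1$. Below, $\otimes$ denotes this monoidal product, and the coherence isomorphisms of the monoidal bicategory are suppressed, as if it were a Gray monoid (in which the only structural 2-cells are the invertible interchange 2-cells $(f\otimes 1)(1\otimes g)\cong(1\otimes g)(f\otimes 1)$ and their tensors and composites). **Skew monoidale.** A skew monoidal structure on an object $A$ consists of arrows $p\colon A\otimes A\to A$ (tensor product) and $j\colon I\to A$ (unit; $I$ is the unit object), and (not necessarily invertible) 2-cells $$\alpha\colon p(p\otimes 1)\Rightarrow p(1\otimes p),\quad \lambda\colon p(j\otimes 1)\Rightarrow 1,\quad \rho\colon 1\Rightarrow p(1\otimes j)$$ satisfying the following five axioms, where $\cong$ denotes interchange 2-cells: 1. the composite $p(p\otimes1)(p\otimes1\otimes1)\xrightarrow{\alpha(p\otimes1\otimes1)}p(1\otimes p)(p\otimes1\otimes1)\cong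 p(p\otimes1)(1\otimes1\otimes p)\xrightarrow{\alpha(1\otimes1\otimes p)}p(1\otimes p)(1\otimes1\otimes p)$ equals $p(p\otimes1)(p\otimes1\otimes1)\xrightarrow{p(\alpha\otimes1)}p(p\otimes1)(1\otimes p\otimes1)\xrightarrow{\alpha(1\otimes p\otimes1)}p(1\otimes p)(1\otimes p\otimes1)\xrightarrow{p(1\otimes\alpha)}p(1\otimes p)(1\otimes1\otimes p)$; 2. the composite $p(p\otimes1)(j\otimes1\otimes1)\xrightarrow{\alpha(j\otimes1\otimes1)}p(1\otimes p)(j\otimes1\otimes1)\cong p(j\otimes1)p\xrightarrow{\lambda p}p$ equals $p(\lambda\otimes1)$; 3. the composite $p\xrightarrow{\rho p}p(1\otimes j)p\cong p(p\otimes1)(1\otimes1\otimes j)\xrightarrow{\alpha(1\otimes1\otimes j)}p(1\otimes p)(1\otimes1\otimes j)$ equals $p(1\otimes\rho)$; 4. the composite $p\xrightarrow{p(\rho\otimes1)}p(p\otimes1)(1\otimes j\otimes1)\xrightarrow{\alpha(1\otimes j\otimes1)}p(1\otimes p)(1\otimes j\otimes1)\xrightarrow{p(1\otimes\lambda)}p$ is the identity; 5. the composite $j\xrightarrow{\rho j}p(1\otimes j)j\cong p(j\otimes1)j\xrightarrow{\lambda j}j$ is the identity. An object with such a structure is a skew monoidale. **Notation for a skew monoidale in Span.** Let $p=\big(C\times C\xleftarrow{(s,r)}E\xrightarrow{t}C\big)$ and $j=\big(1\xleftarrow{!}U\xrightarrow{j}C\big)$; the letter $j$ is used both for the unit and for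 the function $U\to C$. - $p(p\times1)$ has apex $X=\{(f,g)\in E^2: t(f)=s(g)\}$ with legs $(s(f),r(f),r(g))\in C^3$ and $t(g)\in C$. - $p(1\times p)$ has apex $Y=\{(f,g)\in E^2: t(f)=r(g)\}$ with legs $(s(g),s(f),r(f))\in C^3$ and $t(g)\in C$. - Hence $\alpha$ is a function $X\to Y$, written $\alpha(f,g)=(g^f,gf)$, with $s(gf)=s(f)$, $t(gf)=t(g)$, $s(g^f)=r(f)$, $t(g^f)=r(gf)$, $r(g^f)=r(g)$. - $p(1\times j)$ has apex $\{(u,f)\in U\times E: j(u)=r(f)\}$ with legs $s(f)$ and $t(f)$. So $\rho$ is written $\rho(x)=(\psi_x,\phi_x)$, with $\psi_x\in U$, $\phi_x\in E$, $s(\phi_x)=t(\phi_x)=x$ and $j(\psi_x)=r(\phi_x)$. - $p(j\times1)$ has apex $\{(u,f)\in U\times E: j(u)=s(f)\}$ with legs $r(f)$ and $t(f)$. So $\lambda$ exists (and is then unique) if and only if $r(f)=t(f)$ whenever $s(f)=j(u)$ for some $u\in U$. **Coslices and decalage.** For an object $x$ of a category $\mathbb C$, the coslice $(x\downarrow\mathbb C)$ has as objects the arrows $f\colon x\to y$ of $\mathbb C$, and as arrows $f\to f'$ (with $f\colon x\to y$, $f'\colon x\to z$) the arrows $g\colon y\to z$ with $f'=gf$. The functor $\mathrm{Cod}_x\colon(x\downarrow\mathbb C)\to\mathbb C$ sends $f\colon x\to y$ to $y$ and $g\colon f\to gf$ to $g$. The decalage of $\mathbb C$ is $\mathrm{Dec}(\mathbb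 C)=\coprod_{x\in\mathbb C}(x\downarrow\mathbb C)$, and $\mathrm{Cod}\colon\mathrm{Dec}(\mathbb C)\to\mathbb C$ is the functor with components $\mathrm{Cod}_x$. For a functor $F\colon\mathbb X\to\mathbb C$, the functor $\mathrm{Dec}(F)\colon\mathrm{Dec}(\mathbb X)\to\mathrm{Dec}(\mathbb C)$ is given on the summand $(x\downarrow\mathbb X)$ by $(x\downarrow F)\colon(x\downarrow\mathbb X)\to(F(x)\downarrow\mathbb C)$ (apply $F$ to objects and arrows), followed by the inclusion into $\mathrm{Dec}(\mathbb C)$. In $R(1_x)$, the identity $1_x$ is regarded as an object of $(x\downarrow\mathbb C)\subseteq\mathrm{Dec}(\mathbb C)$. *)

theory Defs
  imports Main "HOL-Library.FuncSet"
begin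

section \<open>Categories, functors, decalage\<close>

text \<open>Categories have carrier sets of objects and of arrows. \<open>Comp A g f\<close> is the composite
  \<open>g f\<close> (first \<open>f\<close>). The values of the record fields outside the carriers are irrelevant, so
  equality of categories and of functors is stated on the carriers.\<close>

record ('o, 'a) cat =
  Obj :: "'o set"
  Arr :: "'a set"
  Dom :: "'a \<Rightarrow> 'o"
  Cod :: "'a \<Rightarrow> 'o"
  Ident :: "'o \<Rightarrow> 'a"
  Comp :: "'a \<Rightarrow> 'a \<Rightarrow> 'a"

locale category =
  fixes A :: "('o, 'a) cat"
  assumes dom_obj: "f \<in> Arr A \<Longrightarrow> Dom A f \<in> Obj A"
    and cod_obj: "f \<in> Arr A \<Longrightarrow> Cod A f \<in> Obj A"
    and ident_arr: "x \<in> Obj A \<Longrightarrow> Ident A x \<in> Arr A"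
    and dom_ident: "x \<in> Obj A \<Longrightarrow> Dom A (Ident A x) = x"
    and cod_ident: "x \<in> Obj A \<Longrightarrow> Cod A (Ident A x) = x"
    and comp_arr: "\<lbrakk>f \<in> Arr A; g \<in> Arr A; Cod A f = Dom A g\<rbrakk> \<Longrightarrow> Comp A g f \<in> Arr A"
    and dom_comp: "\<lbrakk>f \<in> Arr A; g \<in> Arr A; Cod A f = Dom A g\<rbrakk> \<Longrightarrow> Dom A (Comp A g f) = Dom A f"
    and cod_comp: "\<lbrakk>f \<in> Arr A; g \<in> Arr A; Cod A f = Dom A g\<rbrakk> \<Longrightarrow> Cod A (Comp A g f) = Cod A g"
    and comp_ident: "f \<in> Arr A \<Longrightarrow> Comp A f (Ident A (Dom A f)) = f"
    and ident_comp: "f \<in> Arr A \<Longrightarrow> Comp A (Ident A (Cod A f)) f = f"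
    and comp_assoc: "\<lbrakk>f \<in> Arr A; g \<in> Arr A; h \<in> Arr A; Cod A f = Dom A g; Cod A g = Dom A h\<rbrakk>
      \<Longrightarrow> Comp A h (Comp A g f) = Comp A (Comp A h g) f"

definition cat_eq :: "('o, 'a) cat \<Rightarrow> ('o, 'a) cat \<Rightarrow> bool" where
  "cat_eq A B \<longleftrightarrow> Obj A = Obj B \<and> Arr A = Arr B
    \<and> (\<forall>f\<in>Arr A. Dom A f = Dom B f \<and> Cod A f = Cod B f)
    \<and> (\<forall>x\<in>Obj A. Ident A x = Ident B x)
    \<and> (\<forall>f\<in>Arr A. \<forall>g\<in>Arr A. Cod A f = Dom A g \<longrightarrow> Comp A g f = Comp B g f)"

record ('o, 'a, 'p, 'b) functor_data =
  FObj :: "'o \<Rightarrow> 'p"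
  FArr :: "'a \<Rightarrow> 'b"

locale cat_functor = A: category A + B: category B
  for A :: "('o, 'a) cat" and B :: "('p, 'b) cat" and F :: "('o, 'a, 'p, 'b) functor_data" +
  assumes fobj: "x \<in> Obj A \<Longrightarrow> FObj F x \<in> Obj B"
    and farr: "f \<in> Arr A \<Longrightarrow> FArr F f \<in> Arr B"
    and fdom: "f \<in> Arr A \<Longrightarrow> Dom B (FArr F f) = FObj F (Dom A f)"
    and fcod: "f \<in> Arr A \<Longrightarrow> Cod B (FArr F f) = FObj F (Cod A f)"
    and fident: "x \<in> Obj A \<Longrightarrow> FArr F (Ident A x) = Ident B (FObj F x)"
    and fcomp: "\<lbrakk>f \<in> Arr A; g \<in> Arr A; Cod A f = Dom A g\<rbrakk>
      \<Longrightarrow> FArr F (Comp A g f) = Comp B (FArr F g) (FArr F f)"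

definition functor_eq ::
    "('o, 'a) cat \<Rightarrow> ('o, 'a, 'p, 'b) functor_data \<Rightarrow> ('o, 'a, 'p, 'b) functor_data \<Rightarrow> bool" where
  "functor_eq A F G \<longleftrightarrow> (\<forall>x\<in>Obj A. FObj F x = FObj G x) \<and> (\<forall>f\<in>Arr A. FArr F f = FArr G f)"

definition functor_comp :: "('p, 'b, 'q, 'c) functor_data \<Rightarrow> ('o, 'a, 'p, 'b) functor_data
    \<Rightarrow> ('o, 'a, 'q, 'c) functor_data"  (infixl "\<circ>\<^sub>F" 55) where
  "G \<circ>\<^sub>F F = \<lparr>FObj = FObj G \<circ> FObj F, FArr = FArr G \<circ> FArr F\<rparr>"

text \<open>The arrow \<open>g: f \<rightarrow> g f\<close> of the coslice is encoded as \<open>(f, g)\<close>; its codomain is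
  determined by \<open>f\<close> and \<open>g\<close>.\<close>

definition coslice :: "'o \<Rightarrow> ('o, 'a) cat \<Rightarrow> ('a, 'a \<times> 'a) cat" where
  "coslice x A = \<lparr>
    Obj = {f \<in> Arr A. Dom A f = x},
    Arr = {(f, g). f \<in> Arr A \<and> Dom A f = x \<and> g \<in> Arr A \<and> Cod A f = Dom A g},
    Dom = \<lambda>(f, g). f,
    Cod = \<lambda>(f, g). Comp A g f,
    Ident = \<lambda>f. (f, Ident A (Cod A f)),
    Comp = \<lambda>(f', g') (f, g). (f, Comp A g' g)\<rparr>"

definition Cod_at :: "'o \<Rightarrow> ('o, 'a) cat \<Rightarrow> ('a, 'a \<times> 'a, 'o, 'a) functor_data" where
  "Cod_at x A = \<lparr>FObj = Cod A, FArr = \<lambda>(f, g). g\<rparr>"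

definition coprod_cat :: "'i set \<Rightarrow> ('i \<Rightarrow> ('o, 'a) cat) \<Rightarrow> ('i \<times> 'o, 'i \<times> 'a) cat" where
  "coprod_cat I K = \<lparr>
    Obj = (SIGMA i:I. Obj (K i)),
    Arr = (SIGMA i:I. Arr (K i)),
    Dom = \<lambda>(i, f). (i, Dom (K i) f),
    Cod = \<lambda>(i, f). (i, Cod (K i) f),
    Ident = \<lambda>(i, x). (i, Ident (K i) x),
    Comp = \<lambda>(i', g) (i, f). (i, Comp (K i) g f)\<rparr>"

definition coprod_incl :: "'i \<Rightarrow> ('o, 'a, 'i \<times> 'o, 'i \<times> 'a) functor_data" where
  "coprod_incl i = \<lparr>FObj = Pair i, FArr = Pair i\<rparr>"

definition coprod_copair ::
    "('i \<Rightarrow> ('o, 'a, 'p, 'b) functor_data) \<Rightarrow> ('i \<times> 'o, 'i \<times> 'a, 'p, 'b) functor_data" where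
  "coprod_copair G = \<lparr>FObj = \<lambda>(i, x). FObj (G i) x, FArr = \<lambda>(i, f). FArr (G i) f\<rparr>"

definition Dec :: "('o, 'a) cat \<Rightarrow> ('o \<times> 'a, 'o \<times> 'a \<times> 'a) cat" where
  "Dec A = coprod_cat (Obj A) (\<lambda>x. coslice x A)"

definition Cod_functor :: "('o, 'a) cat \<Rightarrow> ('o \<times> 'a, 'o \<times> 'a \<times> 'a, 'o, 'a) functor_data" where
  "Cod_functor A = coprod_copair (\<lambda>x. Cod_at x A)"

definition coslice_functor ::
    "('o, 'a, 'p, 'b) functor_data \<Rightarrow> ('a, 'a \<times> 'a, 'b, 'b \<times> 'b) functor_data" where
  "coslice_functor F = \<lparr>FObj = FArr F, FArr = map_prod (FArr F) (FArr F)\<rparr>"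

definition Dec_functor :: "('o, 'a, 'p, 'b) functor_data
    \<Rightarrow> ('o \<times> 'a, 'o \<times> 'a \<times> 'a, 'p \<times> 'b, 'p \<times> 'b \<times> 'b) functor_data" where
  "Dec_functor F = coprod_copair (\<lambda>x. coprod_incl (FObj F x) \<circ>\<^sub>F coslice_functor F)"

text \<open>Functors \<open>R: Dec A \<rightarrow> A\<close> with \<open>R Dec(Cod) = R Dec(R)\<close> and such that
  \<open>x = R(1\<^sub>x)\<close> implies \<open>R\<^sub>x = Cod\<^sub>x\<close>.\<close>

locale decalage_structure = cat_functor "Dec A" A R
  for A :: "('o, 'a) cat" and R :: "('o \<times> 'a, 'o \<times> 'a \<times> 'a, 'o, 'a) functor_data" +
  assumes square:
      "functor_eq (Dec (Dec A)) (R \<circ>\<^sub>F Dec_functor (Cod_functor A)) (R \<circ>\<^sub>F Dec_functor R)"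
    and normal: "\<lbrakk>x \<in> Obj A; x = FObj R (x, Ident A x)\<rbrakk>
      \<Longrightarrow> functor_eq (coslice x A) (R \<circ>\<^sub>F coprod_incl x) (Cod_at x A)"


section \<open>Spans of sets\<close>

record ('a, 'r, 'b) span =
  apex :: "'r set"
  lleg :: "'r \<Rightarrow> 'a"
  rleg :: "'r \<Rightarrow> 'b"

definition is_span :: "'a set \<Rightarrow> 'b set \<Rightarrow> ('a, 'r, 'b) span \<Rightarrow> bool" where
  "is_span A B S \<longleftrightarrow> lleg S \<in> apex S \<rightarrow> A \<and> rleg S \<in> apex S \<rightarrow> B"

definition span_eq :: "('a, 'r, 'b) span \<Rightarrow> ('a, 'r, 'b) span \<Rightarrow> bool" where
  "span_eq S T \<longleftrightarrow> apex S = apex T \<and> (\<forall>x\<in>apex S. lleg S x = lleg T x \<and> rleg S x = rleg T x)"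

definition two_cell ::
    "('a, 'r, 'b) span \<Rightarrow> ('a, 's, 'b) span \<Rightarrow> ('r \<Rightarrow> 's) \<Rightarrow> bool" where
  "two_cell S T \<theta> \<longleftrightarrow> \<theta> \<in> apex S \<rightarrow> apex T
    \<and> (\<forall>x\<in>apex S. lleg T (\<theta> x) = lleg S x \<and> rleg T (\<theta> x) = rleg S x)"

definition id_span :: "'a set \<Rightarrow> ('a, 'a, 'a) span" where
  "id_span A = \<lparr>apex = A, lleg = id, rleg = id\<rparr>"

text \<open>\<open>T \<odot> S\<close> is the composite of \<open>S: A \<rightarrow> B\<close> followed by \<open>T: B \<rightarrow> D\<close>; the elements of the
  pullback are pairs with the component from \<open>S\<close> first.\<close>

definition span_comp :: "('b, 's, 'd) span \<Rightarrow> ('a, 'r, 'b) span \<Rightarrow> ('a, 'r \<times> 's, 'd) span"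
    (infixl "\<odot>" 70) where
  "T \<odot> S = \<lparr>apex = {(x, y). x \<in> apex S \<and> y \<in> apex T \<and> rleg S x = lleg T y},
    lleg = \<lambda>(x, y). lleg S x, rleg = \<lambda>(x, y). rleg T y\<rparr>"

definition span_tensor :: "('a, 'r, 'b) span \<Rightarrow> ('a2, 's, 'b2) span
    \<Rightarrow> ('a \<times> 'a2, 'r \<times> 's, 'b \<times> 'b2) span"  (infixr "\<boxtimes>" 75) where
  "S \<boxtimes> T = \<lparr>apex = apex S \<times> apex T, lleg = map_prod (lleg S) (lleg T),
    rleg = map_prod (rleg S) (rleg T)\<rparr>"

text \<open>The 2-cells \<open>T \<theta>\<close>, \<open>\<theta> Q\<close>, \<open>\<theta> \<otimes> 1\<close>, \<open>1 \<otimes> \<theta>\<close> obtained from a 2-cell \<open>\<theta>\<close>, as functions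
  between the apexes, and vertical composition (in diagrammatic order).\<close>

definition lwhisk :: "('r \<Rightarrow> 's) \<Rightarrow> 'r \<times> 't \<Rightarrow> 's \<times> 't" where
  "lwhisk \<theta> = (\<lambda>(x, y). (\<theta> x, y))"

definition rwhisk :: "('r \<Rightarrow> 's) \<Rightarrow> 'q \<times> 'r \<Rightarrow> 'q \<times> 's" where
  "rwhisk \<theta> = (\<lambda>(x, y). (x, \<theta> y))"

definition tensor_one :: "('r \<Rightarrow> 's) \<Rightarrow> 'r \<times> 't \<Rightarrow> 's \<times> 't" where
  "tensor_one \<theta> = (\<lambda>(x, a). (\<theta> x, a))"

definition one_tensor :: "('r \<Rightarrow> 's) \<Rightarrow> 't \<times> 'r \<Rightarrow> 't \<times> 's" where
  "one_tensor \<theta> = (\<lambda>(a, x). (a, \<theta> x))"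

abbreviation (input) vcomp :: "('r \<Rightarrow> 's) \<Rightarrow> ('s \<Rightarrow> 't) \<Rightarrow> 'r \<Rightarrow> 't"  (infixl ";;" 54) where
  "\<theta> ;; \<eta> \<equiv> \<eta> \<circ> \<theta>"

text \<open>The interchange 2-cell \<open>(1 \<otimes> T)(S \<otimes> 1) \<cong> (S \<otimes> 1)(1 \<otimes> T)\<close>.\<close>

definition interchange :: "('a, 'r, 'b) span \<Rightarrow> ('a2, 's, 'b2) span
    \<Rightarrow> ('r \<times> 'a2) \<times> ('b \<times> 's) \<Rightarrow> ('a \<times> 's) \<times> ('r \<times> 'b2)" where
  "interchange S T = (\<lambda>((x, a), (b, y)). ((lleg S x, y), (x, rleg T y)))"

text \<open>Coherence bijections. On apexes, \<open>assoc_right\<close> and \<open>assoc_left\<close> serve as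
  \<open>(Q \<otimes> S) \<otimes> T \<cong> Q \<otimes> (S \<otimes> T)\<close> and, because of the order of components in a composite,
  as \<open>Q (S T) \<cong> (Q S) T\<close>.\<close>

definition assoc_right :: "('r \<times> 's) \<times> 't \<Rightarrow> 'r \<times> 's \<times> 't" where
  "assoc_right = (\<lambda>((x, y), z). (x, (y, z)))"

definition assoc_left :: "'r \<times> 's \<times> 't \<Rightarrow> ('r \<times> 's) \<times> 't" where
  "assoc_left = (\<lambda>(x, (y, z)). ((x, y), z))"

text \<open>The unit coherences \<open>S \<cong> S 1\<close> and \<open>S \<cong> 1 S\<close>; their inverses are the projections \<open>snd\<close>
  and \<open>fst\<close>.\<close>

definition to_comp_one :: "('a, 'r, 'b) span \<Rightarrow> 'r \<Rightarrow> 'a \<times> 'r" where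
  "to_comp_one S = (\<lambda>x. (lleg S x, x))"

definition to_one_comp :: "('a, 'r, 'b) span \<Rightarrow> 'r \<Rightarrow> 'r \<times> 'b" where
  "to_one_comp S = (\<lambda>x. (x, rleg S x))"

text \<open>\<open>(T \<otimes> 1)(S \<otimes> 1) \<cong> T S \<otimes> 1\<close> and \<open>(1 \<otimes> T)(1 \<otimes> S) \<cong> 1 \<otimes> T S\<close>, with inverses.\<close>

definition merge_right :: "('r \<times> 'a) \<times> ('s \<times> 'a) \<Rightarrow> ('r \<times> 's) \<times> 'a" where
  "merge_right = (\<lambda>((x, a), (y, b)). ((x, y), a))"

definition split_right :: "('r \<times> 's) \<times> 'a \<Rightarrow> ('r \<times> 'a) \<times> ('s \<times> 'a)" where
  "split_right = (\<lambda>((x, y), a). ((x, a), (y, a)))"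

definition merge_left :: "('a \<times> 'r) \<times> ('a \<times> 's) \<Rightarrow> 'a \<times> ('r \<times> 's)" where
  "merge_left = (\<lambda>((a, x), (b, y)). (a, (x, y)))"

definition split_left :: "'a \<times> ('r \<times> 's) \<Rightarrow> ('a \<times> 'r) \<times> ('a \<times> 's)" where
  "split_left = (\<lambda>(a, (x, y)). ((a, x), (a, y)))"

text \<open>Reparametrization of the domain of a span along a coherence bijection of sets
  \<open>(A \<times> B) \<times> D \<cong> A \<times> (B \<times> D)\<close>, \<open>1 \<times> A \<cong> A\<close> or \<open>A \<times> 1 \<cong> A\<close>.\<close>

definition reindex :: "('a \<Rightarrow> 'a2) \<Rightarrow> ('a, 'r, 'b) span \<Rightarrow> ('a2, 'r, 'b) span" where
  "reindex k S = \<lparr>apex = apex S, lleg = k \<circ> lleg S, rleg = rleg S\<rparr>"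


section \<open>Skew monoidales in Span\<close>

record ('c, 'e, 'u) skew_data =
  tens :: "('c \<times> 'c, 'e, 'c) span"
  unt :: "(unit, 'u, 'c) span"
  alpha :: "('e \<times> 'c) \<times> 'e \<Rightarrow> ('c \<times> 'e) \<times> 'e"
  lam :: "('u \<times> 'c) \<times> 'e \<Rightarrow> 'c"
  rho :: "'c \<Rightarrow> ('c \<times> 'u) \<times> 'e"

text \<open>Domains are brought into the right-nested form \<open>C\<close>, \<open>C \<times> C\<close>, \<open>C \<times> (C \<times> C)\<close>,
  \<open>C \<times> (C \<times> (C \<times> C))\<close>, and the identity of the unit object is dropped. Thus \<open>p1\<close>, \<open>p11\<close>,
  \<open>one_p\<close>, \<open>j1\<close>, \<open>j11\<close>, \<open>one_j\<close> are \<open>p \<otimes> 1\<close>, \<open>p \<otimes> 1 \<otimes> 1\<close>, \<open>1 \<otimes> p\<close>, \<open>j \<otimes> 1\<close>, \<open>j \<otimes> 1 \<otimes> 1\<close>,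
  \<open>1 \<otimes> j\<close>, with the repeated identity in \<open>p11\<close> and \<open>j11\<close> taken as the identity of \<open>C \<times> C\<close>.
  The 2-cells of the axioms are equated on the apex of their common domain; the comment on each
  line shows the composite span reached after it, in the notation \<open>1p\<close>, \<open>1p1\<close>, \<open>11p\<close>, \<open>1j\<close>,
  \<open>1j1\<close>, \<open>11j\<close> for the tensors of \<open>p\<close> and \<open>j\<close> with identities.\<close>

locale skew_monoidale =
  fixes C :: "'c set" and M :: "('c, 'e, 'u) skew_data"
  fixes p and j and p1 and p11 and one_p and j1 and j11 and one_j
  defines "p \<equiv> tens M" and "j \<equiv> unt M"
    and "p1 \<equiv> reindex assoc_right (p \<boxtimes> id_span C)"
    and "p11 \<equiv> reindex assoc_right (p \<boxtimes> id_span (C \<times> C))"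
    and "one_p \<equiv> id_span C \<boxtimes> p"
    and "j1 \<equiv> reindex snd (j \<boxtimes> id_span C)"
    and "j11 \<equiv> reindex snd (j \<boxtimes> id_span (C \<times> C))"
    and "one_j \<equiv> reindex fst (id_span C \<boxtimes> j)"
  assumes tens_span: "is_span (C \<times> C) C p"
    and unit_span: "is_span {()} C j"
    and alpha_cell: "two_cell (p \<odot> p1) (p \<odot> one_p) (alpha M)"
    and lam_cell: "two_cell (p \<odot> j1) (id_span C) (lam M)"
    and rho_cell: "two_cell (id_span C) (p \<odot> one_j) (rho M)"
    and axiom1: "\<forall>z \<in> apex (p \<odot> p1 \<odot> p11).
      (                                                    \<comment> \<open>\<open>(p (p1)) (p11)\<close>\<close>
        rwhisk (alpha M)                                   \<comment> \<open>\<open>(p (1p)) (p11)\<close>\<close>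
        ;; assoc_left                                      \<comment> \<open>\<open>p ((1p) (p11))\<close>\<close>
        ;; lwhisk (interchange p p ;; lwhisk assoc_right)  \<comment> \<open>\<open>p ((p1) (11p))\<close>\<close>
        ;; assoc_right                                     \<comment> \<open>\<open>(p (p1)) (11p)\<close>\<close>
        ;; rwhisk (alpha M)                                \<comment> \<open>\<open>(p (1p)) (11p)\<close>\<close>
      ) z =
      (                                                    \<comment> \<open>\<open>(p (p1)) (p11)\<close>\<close>
        assoc_left                                         \<comment> \<open>\<open>p ((p1) (p11))\<close>\<close>
        ;; lwhisk (lwhisk assoc_left ;; merge_right)       \<comment> \<open>\<open>p ((p (p1)) \<otimes> 1)\<close>\<close>
        ;; lwhisk (tensor_one (alpha M))                   \<comment> \<open>\<open>p ((p (1p)) \<otimes> 1)\<close>\<close>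
        ;; lwhisk (split_right ;; lwhisk assoc_right)      \<comment> \<open>\<open>p ((p1) (1p1))\<close>\<close>
        ;; assoc_right                                     \<comment> \<open>\<open>(p (p1)) (1p1)\<close>\<close>
        ;; rwhisk (alpha M)                                \<comment> \<open>\<open>(p (1p)) (1p1)\<close>\<close>
        ;; assoc_left                                      \<comment> \<open>\<open>p ((1p) (1p1))\<close>\<close>
        ;; lwhisk merge_left                               \<comment> \<open>\<open>p (1 \<otimes> (p (p1)))\<close>\<close>
        ;; lwhisk (one_tensor (alpha M))                   \<comment> \<open>\<open>p (1 \<otimes> (p (1p)))\<close>\<close>
        ;; lwhisk split_left                               \<comment> \<open>\<open>p ((1p) (11p))\<close>\<close>
        ;; assoc_right                                     \<comment> \<open>\<open>(p (1p)) (11p)\<close>\<close>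
      ) z"
    and axiom2: "\<forall>z \<in> apex (p \<odot> p1 \<odot> j11).
      (                                                    \<comment> \<open>\<open>(p (p1)) (j11)\<close>\<close>
        rwhisk (alpha M)                                   \<comment> \<open>\<open>(p (1p)) (j11)\<close>\<close>
        ;; assoc_left                                      \<comment> \<open>\<open>p ((1p) (j11))\<close>\<close>
        ;; lwhisk (interchange j p ;; lwhisk snd)          \<comment> \<open>\<open>p ((j1) p)\<close>\<close>
        ;; assoc_right                                     \<comment> \<open>\<open>(p (j1)) p\<close>\<close>
        ;; rwhisk (lam M)                                  \<comment> \<open>\<open>1 p\<close>\<close>
        ;; fst                                             \<comment> \<open>\<open>p\<close>\<close>
      ) z =
      (                                                    \<comment> \<open>\<open>(p (p1)) (j11)\<close>\<close>
        assoc_left                                         \<comment> \<open>\<open>p ((p1) (j11))\<close>\<close>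
        ;; lwhisk (lwhisk assoc_left ;; merge_right)       \<comment> \<open>\<open>p ((p (j1)) \<otimes> 1)\<close>\<close>
        ;; lwhisk (tensor_one (lam M))                     \<comment> \<open>\<open>p (1 \<otimes> 1)\<close>\<close>
        ;; snd                                             \<comment> \<open>\<open>p\<close>\<close>
      ) z"
    and axiom3: "\<forall>z \<in> apex p.
      (                                                    \<comment> \<open>\<open>p\<close>\<close>
        to_one_comp p                                      \<comment> \<open>\<open>1 p\<close>\<close>
        ;; rwhisk (rho M)                                  \<comment> \<open>\<open>(p (1j)) p\<close>\<close>
        ;; assoc_left                                      \<comment> \<open>\<open>p ((1j) p)\<close>\<close>
        ;; lwhisk (lwhisk (\<lambda>e. (e, ())) ;; interchange p j ;; lwhisk assoc_right)
                                                           \<comment> \<open>\<open>p ((p1) (11j))\<close>\<close>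
        ;; assoc_right                                     \<comment> \<open>\<open>(p (p1)) (11j)\<close>\<close>
        ;; rwhisk (alpha M)                                \<comment> \<open>\<open>(p (1p)) (11j)\<close>\<close>
      ) z =
      (                                                    \<comment> \<open>\<open>p\<close>\<close>
        to_comp_one p                                      \<comment> \<open>\<open>p (1 \<otimes> 1)\<close>\<close>
        ;; lwhisk (one_tensor (rho M))                     \<comment> \<open>\<open>p (1 \<otimes> (p (1j)))\<close>\<close>
        ;; lwhisk split_left                               \<comment> \<open>\<open>p ((1p) (11j))\<close>\<close>
        ;; assoc_right                                     \<comment> \<open>\<open>(p (1p)) (11j)\<close>\<close>
      ) z"
    and axiom4: "\<forall>z \<in> apex p.
      (                                                    \<comment> \<open>\<open>p\<close>\<close>
        to_comp_one p                                      \<comment> \<open>\<open>p (1 \<otimes> 1)\<close>\<close>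
        ;; lwhisk (tensor_one (rho M))                     \<comment> \<open>\<open>p ((p (1j)) \<otimes> 1)\<close>\<close>
        ;; lwhisk (split_right ;; lwhisk assoc_right)      \<comment> \<open>\<open>p ((p1) (1j1))\<close>\<close>
        ;; assoc_right                                     \<comment> \<open>\<open>(p (p1)) (1j1)\<close>\<close>
        ;; rwhisk (alpha M)                                \<comment> \<open>\<open>(p (1p)) (1j1)\<close>\<close>
        ;; assoc_left                                      \<comment> \<open>\<open>p ((1p) (1j1))\<close>\<close>
        ;; lwhisk merge_left                               \<comment> \<open>\<open>p (1 \<otimes> (p (j1)))\<close>\<close>
        ;; lwhisk (one_tensor (lam M))                     \<comment> \<open>\<open>p (1 \<otimes> 1)\<close>\<close>
        ;; snd                                             \<comment> \<open>\<open>p\<close>\<close>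
      ) z = z"
    and axiom5: "\<forall>z \<in> apex j.
      (                                                    \<comment> \<open>\<open>j\<close>\<close>
        to_one_comp j                                      \<comment> \<open>\<open>1 j\<close>\<close>
        ;; rwhisk (rho M)                                  \<comment> \<open>\<open>(p (1j)) j\<close>\<close>
        ;; assoc_left                                      \<comment> \<open>\<open>p ((1j) j)\<close>\<close>
        ;; lwhisk (lwhisk (\<lambda>u. (u, ())) ;; interchange j j ;; lwhisk snd)
                                                           \<comment> \<open>\<open>p ((j1) j)\<close>\<close>
        ;; assoc_right                                     \<comment> \<open>\<open>(p (j1)) j\<close>\<close>
        ;; rwhisk (lam M)                                  \<comment> \<open>\<open>1 j\<close>\<close>
        ;; fst                                             \<comment> \<open>\<open>j\<close>\<close>
      ) z = z"


section \<open>The category and the functor of a skew monoidale\<close>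

context
  fixes M :: "('c, 'e, 'u) skew_data"
begin

definition s_of :: "'e \<Rightarrow> 'c" where "s_of f = fst (lleg (tens M) f)"
definition r_of :: "'e \<Rightarrow> 'c" where "r_of f = snd (lleg (tens M) f)"
definition t_of :: "'e \<Rightarrow> 'c" where "t_of f = rleg (tens M) f"

text \<open>For \<open>t(f) = s(g)\<close>, the pair \<open>(f, g)\<close> of \<open>X\<close> is the element \<open>((f, r(g)), g)\<close> of the apex of
  \<open>p (p \<otimes> 1)\<close>, and a pair \<open>(g\<^sup>f, g f)\<close> of \<open>Y\<close> is obtained from an element of the apex of
  \<open>p (1 \<otimes> p)\<close> by dropping its component in \<open>C\<close>; similarly for \<open>\<rho>\<close>.\<close>

definition act :: "'e \<Rightarrow> 'e \<Rightarrow> 'e" where  \<comment> \<open>\<open>g\<^sup>f\<close>\<close>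
  "act f g = snd (fst (alpha M ((f, r_of g), g)))"

definition mult :: "'e \<Rightarrow> 'e \<Rightarrow> 'e" where  \<comment> \<open>\<open>g f\<close>\<close>
  "mult f g = snd (alpha M ((f, r_of g), g))"

definition psi :: "'c \<Rightarrow> 'u" where "psi x = snd (fst (rho M x))"
definition phi :: "'c \<Rightarrow> 'e" where "phi x = snd (rho M x)"

definition induced_cat :: "'c set \<Rightarrow> ('c, 'e) cat" where
  "induced_cat C = \<lparr>Obj = C, Arr = apex (tens M), Dom = s_of, Cod = t_of,
    Ident = phi, Comp = \<lambda>g f. mult f g\<rparr>"

definition induced_functor :: "('c \<times> 'e, 'c \<times> 'e \<times> 'e, 'c, 'e) functor_data" where
  "induced_functor = \<lparr>FObj = \<lambda>(x, f). r_of f, FArr = \<lambda>(x, (f, g)). act f g\<rparr>"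

end

definition induces :: "'c set \<Rightarrow> ('c, 'e, 'u) skew_data \<Rightarrow> ('c, 'e) cat
    \<Rightarrow> ('c \<times> 'e, 'c \<times> 'e \<times> 'e, 'c, 'e) functor_data \<Rightarrow> bool" where
  "induces C M A R \<longleftrightarrow> cat_eq (induced_cat M C) A \<and> functor_eq (Dec A) (induced_functor M) R"

text \<open>\<open>h\<close> is an isomorphism from the unit span of \<open>M\<close> to that of \<open>N\<close>; the tensor spans and the
  2-cells \<open>\<alpha>\<close> agree, and \<open>\<lambda>\<close> and \<open>\<rho>\<close> correspond to each other under
  \<open>p (h \<otimes> 1)\<close> and \<open>p (1 \<otimes> h)\<close>.\<close>

definition unit_change :: "'c set \<Rightarrow> ('c, 'e, 'u) skew_data \<Rightarrow> ('c, 'e, 'v) skew_data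
    \<Rightarrow> ('u \<Rightarrow> 'v) \<Rightarrow> bool" where
  "unit_change C M N h \<longleftrightarrow>
    two_cell (unt M) (unt N) h \<and> bij_betw h (apex (unt M)) (apex (unt N))
    \<and> span_eq (tens M) (tens N)
    \<and> (\<forall>z \<in> apex (tens M \<odot> reindex assoc_right (tens M \<boxtimes> id_span C)). alpha N z = alpha M z)
    \<and> (\<forall>z \<in> apex (tens M \<odot> reindex snd (unt M \<boxtimes> id_span C)).
          lam N (lwhisk (tensor_one h) z) = lam M z)
    \<and> (\<forall>x\<in>C. rho N x = lwhisk (one_tensor h) (rho M x))"

end

theory Submission
  imports Defs
begin

text \<open>
  Write \<open>(E; s, r, t)\<close> for the tensor span. A 2-cell between spans is determined by its values,
  so each of the five axioms is a list of equations between elements of \<open>E\<close> and of \<open>U\<close>, the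
  components in \<open>C\<close> being legs of these. For composable \<open>f\<close>, \<open>g\<close>, \<open>h\<close>, axiom 1 reads
  \<open>h (g f) = (h g) f\<close>, \<open>(h g)\<^sup>f = k g\<^sup>f\<close> and \<open>h\<^sup>g = k\<^bsup>l\<^esup>\<close>, where \<open>k = h\<^bsup>g f\<^esup>\<close> and \<open>l = g\<^sup>f\<close>:
  the first is associativity, the second says that \<open>R\<close> preserves composition, and the third is the
  square (b) on arrows (on objects (b) is the equation \<open>r(g\<^sup>f) = r(g)\<close>, which holds since
  \<open>\<alpha>\<close> commutes with the legs). Axiom 4 is one unit law; axiom 3 gives the other unit law, the
  equation \<open>(1\<^bsub>t(f)\<^esub>)\<^sup>f = 1\<^bsub>r(f)\<^esub>\<close>, which is the preservation of identities by \<open>R\<close>, and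
  \<open>\<psi>\<^bsub>t(f)\<^esub> = \<psi>\<^bsub>r(f)\<^esub>\<close>. The existence of \<open>\<lambda>\<close> and axiom 2 say that \<open>r(f) = t(f)\<close> and
  \<open>g\<^sup>f = g\<close> whenever \<open>s(f)\<close> is in the image of \<open>j\<close>. Axiom 5 says \<open>\<psi> j = 1\<close>; since moreover
  \<open>j(\<psi>(x)) = r(1\<^sub>x)\<close>, the functions \<open>j\<close> and \<open>\<psi>\<close> split \<open>e(x) = R(1\<^sub>x)\<close>. In particular the image of \<open>j\<close> is
  the set of fixed points of \<open>e\<close>, which turns the statement about \<open>\<lambda>\<close> and axiom 2 into (c).
  This gives part (i) (\<open>decalage_induced\<close>).

  For the converse, the unit span is taken to be the inclusion of the fixed points of \<open>e\<close>, and
  the equations above are read backwards (\<open>skew_monoidale_skew_of\<close>). Two consequences of (b) are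
  needed which are not among the conditions themselves: evaluated at an identity arrow of a coslice,
  it yields \<open>e(r(f)) = e(t(f))\<close>, and for \<open>f = 1\<^sub>x\<close> this is the idempotence of \<open>e\<close>.

  Uniqueness holds because a splitting of an idempotent is unique up to a unique isomorphism: the
  comparison of two unit spans is \<open>\<psi>\<^sub>N j\<^sub>M\<close>, with inverse \<open>\<psi>\<^sub>M j\<^sub>N\<close>, while all other data are
  values or legs recorded by the category and \<open>R\<close> (\<open>unit_change_exists\<close>).
\<close>

section \<open>The decalage of a category\<close>

lemma Dec_simps:
  "Obj (Dec A) = {(x, f). x \<in> Obj A \<and> f \<in> Arr A \<and> Dom A f = x}"
  "Arr (Dec A) = {(x, f, g). x \<in> Obj A \<and> f \<in> Arr A \<and> Dom A f = x \<and> g \<in> Arr A \<and> Cod A f = Dom A g}"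
  "Dom (Dec A) (x, f, g) = (x, f)"
  "Cod (Dec A) (x, f, g) = (x, Comp A g f)"
  "Ident (Dec A) (x, f) = (x, f, Ident A (Cod A f))"
  "Comp (Dec A) (y, f', g') (x, f, g) = (x, f, Comp A g' g)"
  by (auto simp: Dec_def coprod_cat_def coslice_def)

lemma (in category) category_Dec: "category (Dec A)"
proof (unfold_locales, goal_cases)
  case (1 f) then show ?case by (cases f) (simp add: Dec_simps)
next
  case (2 f) then show ?case by (cases f) (simp add: Dec_simps comp_arr dom_comp)
next
  case (3 x) then show ?case by (cases x) (auto simp: Dec_simps cod_obj ident_arr dom_ident)
next
  case (4 x) then show ?case by (cases x) (simp add: Dec_simps)
next
  case (5 x) then show ?case by (cases x) (simp add: Dec_simps ident_comp)
next
  case (6 f g) then show ?case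
    by (cases f; cases g) (auto simp: Dec_simps comp_arr dom_comp cod_comp)
next
  case (7 f g) then show ?case by (cases f; cases g) (simp add: Dec_simps)
next
  case (8 f g) then show ?case by (cases f; cases g) (auto simp: Dec_simps comp_assoc cod_comp)
next
  case (9 f) then show ?case by (cases f) (simp add: Dec_simps comp_ident)
next
  case (10 f) then show ?case by (cases f) (auto simp: Dec_simps cod_comp ident_comp)
next
  case (11 f g h) then show ?case
    by (cases f; cases g; cases h) (auto simp: Dec_simps comp_assoc cod_comp)
qed

context category
begin

text \<open>An object of \<open>Dec (Dec A)\<close> is a composable pair and an arrow a composable triple of \<open>A\<close>: the
  other components of the nested tuples repeat domains and composites of these. So the square (b)
  is a family of equations indexed by pairs and triples.\<close>

lemma Dec_Dec_objects:
  "(\<forall>z\<in>Obj (Dec (Dec A)). P z) \<longleftrightarrow>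
    (\<forall>f\<in>Arr A. \<forall>g\<in>Arr A. Cod A f = Dom A g \<longrightarrow> P ((Dom A f, f), Dom A f, f, g))"
  by (auto simp: Dec_simps dom_obj)

lemma Dec_Dec_arrows:
  "(\<forall>z\<in>Arr (Dec (Dec A)). P z) \<longleftrightarrow>
    (\<forall>f\<in>Arr A. \<forall>g\<in>Arr A. \<forall>h\<in>Arr A. Cod A f = Dom A g \<and> Cod A g = Dom A h \<longrightarrow>
      P ((Dom A f, f), (Dom A f, f, g), (Dom A f, Comp A g f, h)))"
proof -
  have "z \<in> Arr (Dec (Dec A)) \<longleftrightarrow> (\<exists>f g h. f \<in> Arr A \<and> g \<in> Arr A \<and> h \<in> Arr A
      \<and> Cod A f = Dom A g \<and> Cod A g = Dom A h
      \<and> z = ((Dom A f, f), (Dom A f, f, g), (Dom A f, Comp A g f, h)))" for z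
  proof -
    obtain x0 f0 x f g x' f' h where z: "z = ((x0, f0), (x, f, g), (x', f', h))"
      by (metis surj_pair)
    have "z \<in> Arr (Dec (Dec A)) \<longleftrightarrow> f \<in> Arr A \<and> g \<in> Arr A \<and> h \<in> Arr A
      \<and> Cod A f = Dom A g \<and> Cod A g = Dom A h
      \<and> x0 = Dom A f \<and> f0 = f \<and> x = Dom A f \<and> x' = Dom A f \<and> f' = Comp A g f"
      unfolding z Dec_simps mem_Collect_eq prod.case prod.inject
      using cod_comp[of f g] dom_comp[of f g] comp_arr[of f g] dom_obj[of f] by metis
    then show ?thesis
      unfolding z by auto
  qed
  then show ?thesis
    by metis
qed

lemma square_iff:
  "functor_eq (Dec (Dec A)) (R \<circ>\<^sub>F Dec_functor (Cod_functor A)) (R \<circ>\<^sub>F Dec_functor R) \<longleftrightarrow>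
    (\<forall>f\<in>Arr A. \<forall>g\<in>Arr A. Cod A f = Dom A g \<longrightarrow>
        FObj R (Cod A f, g) = FObj R (FObj R (Dom A f, f), FArr R (Dom A f, f, g)))
    \<and> (\<forall>f\<in>Arr A. \<forall>g\<in>Arr A. \<forall>h\<in>Arr A. Cod A f = Dom A g \<and> Cod A g = Dom A h \<longrightarrow>
        FArr R (Cod A f, g, h) = FArr R (FObj R (Dom A f, f), FArr R (Dom A f, f, g),
          FArr R (Dom A f, Comp A g f, h)))"
  unfolding functor_eq_def Dec_Dec_objects Dec_Dec_arrows
  by (simp add: functor_comp_def Dec_functor_def Cod_functor_def Cod_at_def coprod_copair_def
      coprod_incl_def coslice_functor_def)

text \<open>The fixed point condition is turned around because \<open>x = FObj R (x, Ident A x)\<close> loops as a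
  rewrite rule.\<close>

lemma normal_iff:
  "(\<forall>x. x \<in> Obj A \<longrightarrow> x = FObj R (x, Ident A x) \<longrightarrow>
      functor_eq (coslice x A) (R \<circ>\<^sub>F coprod_incl x) (Cod_at x A)) \<longleftrightarrow>
    (\<forall>f\<in>Arr A. FObj R (Dom A f, Ident A (Dom A f)) = Dom A f \<longrightarrow>
      FObj R (Dom A f, f) = Cod A f
      \<and> (\<forall>g\<in>Arr A. Cod A f = Dom A g \<longrightarrow> FArr R (Dom A f, f, g) = g))"
proof -
  have "functor_eq (coslice x A) (R \<circ>\<^sub>F coprod_incl x) (Cod_at x A) \<longleftrightarrow>
      (\<forall>f\<in>Arr A. Dom A f = x \<longrightarrow> FObj R (x, f) = Cod A f
        \<and> (\<forall>g\<in>Arr A. Cod A f = Dom A g \<longrightarrow> FArr R (x, f, g) = g))" for x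
    by (auto simp: functor_eq_def functor_comp_def Cod_at_def coprod_incl_def coslice_def)
  moreover have "x = FObj R (x, Ident A x) \<longleftrightarrow> FObj R (x, Ident A x) = x" for x
    by (rule eq_commute)
  ultimately show ?thesis
    by (auto simp: dom_obj)
qed

end

lemma decalage_structure_iff:
  "decalage_structure A R \<longleftrightarrow> cat_functor (Dec A) A R
    \<and> (\<forall>f\<in>Arr A. \<forall>g\<in>Arr A. Cod A f = Dom A g \<longrightarrow>
        FObj R (Cod A f, g) = FObj R (FObj R (Dom A f, f), FArr R (Dom A f, f, g)))
    \<and> (\<forall>f\<in>Arr A. \<forall>g\<in>Arr A. \<forall>h\<in>Arr A. Cod A f = Dom A g \<and> Cod A g = Dom A h \<longrightarrow>
        FArr R (Cod A f, g, h) = FArr R (FObj R (Dom A f, f), FArr R (Dom A f, f, g),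
          FArr R (Dom A f, Comp A g f, h)))
    \<and> (\<forall>f\<in>Arr A. FObj R (Dom A f, Ident A (Dom A f)) = Dom A f \<longrightarrow>
      FObj R (Dom A f, f) = Cod A f
      \<and> (\<forall>g\<in>Arr A. Cod A f = Dom A g \<longrightarrow> FArr R (Dom A f, f, g) = g))"
proof (cases "cat_functor (Dec A) A R")
  case True
  then interpret cat_functor "Dec A" A R .
  show ?thesis
    unfolding decalage_structure_def decalage_structure_axioms_def
    using True B.square_iff[of R] B.normal_iff[of R] by presburger
next
  case False
  then show ?thesis
    by (simp add: decalage_structure_def)
qed

section \<open>From skew monoidales to decalage structures\<close>

lemmas cell_simps = rwhisk_def lwhisk_def assoc_left_def assoc_right_def interchange_def
  merge_right_def split_right_def merge_left_def split_left_def tensor_one_def one_tensor_def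
  to_comp_one_def to_one_comp_def

lemmas span_simps = span_comp_def span_tensor_def reindex_def id_span_def assoc_right_def

context skew_monoidale
begin


abbreviation "E \<equiv> apex (tens M)"
abbreviation "U \<equiv> apex (unt M)"
abbreviation "s \<equiv> s_of M"
abbreviation "r \<equiv> r_of M"
abbreviation "t \<equiv> t_of M"
text \<open>The right leg of the unit span is called \<open>i\<close>, as \<open>j\<close> denotes the span itself.\<close>

abbreviation "i \<equiv> rleg (unt M)"

lemmas composite_simps = p_def j_def p1_def p11_def one_p_def j1_def j11_def one_j_def span_simps

lemma lleg_tens: "lleg (tens M) f = (s f, r f)"
  by (simp add: s_of_def r_of_def)

lemma rleg_tens: "rleg (tens M) f = t f"
  by (simp add: t_of_def)

lemmas legs = lleg_tens rleg_tens

lemma leg_in: assumes "f \<in> E" shows "s f \<in> C" "r f \<in> C" "t f \<in> C"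
  using tens_span assms by (auto simp: is_span_def p_def legs Pi_iff)

lemma unit_leg_in: assumes "u \<in> U" shows "i u \<in> C"
  using unit_span assms by (auto simp: is_span_def j_def Pi_iff)

text \<open>The apex of \<open>p (p \<otimes> 1)\<close> consists of the elements \<open>((f, r g), g)\<close>, and the component of
  \<open>\<alpha>\<close> in \<open>C\<close> is the first coordinate of the left leg, so \<open>\<alpha>\<close> carries no information beyond
  \<open>g\<^sup>f\<close> and \<open>g f\<close>. The remaining equations express compatibility with the legs.\<close>

lemma
  assumes "f \<in> E" "g \<in> E" "t f = s g"
  shows alpha_eq: "alpha M ((f, r g), g) = ((s f, act M f g), mult M f g)"
    and act_in: "act M f g \<in> E" and mult_in: "mult M f g \<in> E"
    and s_act: "s (act M f g) = r f" and r_act: "r (act M f g) = r g" 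
    and t_act: "t (act M f g) = r (mult M f g)"
    and s_mult: "s (mult M f g) = s f" and t_mult: "t (mult M f g) = t g"
proof -
  have z: "((f, r g), g) \<in> apex (p \<odot> p1)"
    using assms leg_in by (auto simp: composite_simps legs)
  obtain c a m where a: "alpha M ((f, r g), g) = ((c, a), m)"
    by (metis surj_pair)
  have am: "act M f g = a" "mult M f g = m"
    by (simp_all add: act_def mult_def a)
  have "((c, a), m) \<in> apex (p \<odot> one_p)"
    using alpha_cell z a unfolding two_cell_def by (metis PiE)
  moreover have "lleg (p \<odot> one_p) ((c, a), m) = lleg (p \<odot> p1) ((f, r g), g)"
    "rleg (p \<odot> one_p) ((c, a), m) = rleg (p \<odot> p1) ((f, r g), g)"
    using alpha_cell z a unfolding two_cell_def by metis+
  ultimately show "alpha M ((f, r g), g) = ((s f, act M f g), mult M f g)"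
    "act M f g \<in> E" "mult M f g \<in> E"
    "s (act M f g) = r f" "r (act M f g) = r g" "t (act M f g) = r (mult M f g)"
    "s (mult M f g) = s f" "t (mult M f g) = t g"
    by (auto simp: composite_simps legs am a)
qed

text \<open>The span \<open>p (j \<otimes> 1)\<close> has legs \<open>r\<close> and \<open>t\<close>, while those of the identity span coincide; so
  the mere existence of \<open>\<lambda>\<close> gives \<open>r f = t f\<close>.\<close>

lemma
  assumes "u \<in> U" "f \<in> E" "i u = s f"
  shows lam_eq: "lam M ((u, r f), f) = t f" and r_eq_t: "r f = t f"
proof -
  have z: "((u, r f), f) \<in> apex (p \<odot> j1)"
    using assms leg_in by (auto simp: composite_simps legs)
  have "lleg (id_span C) (lam M ((u, r f), f)) = lleg (p \<odot> j1) ((u, r f), f)"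
    "rleg (id_span C) (lam M ((u, r f), f)) = rleg (p \<odot> j1) ((u, r f), f)"
    using lam_cell z unfolding two_cell_def by metis+
  then show "lam M ((u, r f), f) = t f" "r f = t f"
    by (auto simp: composite_simps legs)
qed

lemma
  assumes "x \<in> C"
  shows rho_eq: "rho M x = ((x, psi M x), phi M x)"
    and psi_in: "psi M x \<in> U" and phi_in: "phi M x \<in> E"
    and s_phi: "s (phi M x) = x" and t_phi: "t (phi M x) = x" and i_psi: "i (psi M x) = r (phi M x)"
proof -
  obtain c a m where a: "rho M x = ((c, a), m)"
    by (metis surj_pair)
  have am: "psi M x = a" "phi M x = m"
    by (simp_all add: psi_def phi_def a)
  have z: "x \<in> apex (id_span C)"
    using assms by (simp add: id_span_def)
  have "((c, a), m) \<in> apex (p \<odot> one_j)"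
    using rho_cell z a unfolding two_cell_def by (metis PiE)
  moreover have "lleg (p \<odot> one_j) ((c, a), m) = lleg (id_span C) x"
    "rleg (p \<odot> one_j) ((c, a), m) = rleg (id_span C) x"
    using rho_cell z a unfolding two_cell_def by metis+
  ultimately show "rho M x = ((x, psi M x), phi M x)" "psi M x \<in> U" "phi M x \<in> E"
    "s (phi M x) = x" "t (phi M x) = x" "i (psi M x) = r (phi M x)"
    by (auto simp: composite_simps legs am a)
qed

text \<open>Axiom 1 at the triple \<open>(f, g, h)\<close> splits into associativity, the functoriality of \<open>R\<close> and the
  square (b) on arrows.\<close>

lemma
  assumes "f \<in> E" "g \<in> E" "h \<in> E" "t f = s g" "t g = s h"
  shows mult_assoc: "mult M f (mult M g h) = mult M (mult M f g) h"
    and act_mult: "act M f (mult M g h) = mult M (act M f g) (act M (mult M f g) h)"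
    and act_act: "act M g h = act M (act M f g) (act M (mult M f g) h)"
proof -
  have z: "((f, r g, r h), (g, r h), h) \<in> apex (p \<odot> p1 \<odot> p11)"
    using assms leg_in by (auto simp: composite_simps legs)
  note e = alpha_eq[of g h] r_act[of g h] t_act[of g h] s_act[of g h] mult_in[of g h] act_in[of g h]
    s_mult[of g h]
    alpha_eq[of f g] r_act[of f g] t_act[of f g] s_act[of f g] mult_in[of f g] act_in[of f g]
    s_mult[of f g] t_mult[of f g]
  have a1: "alpha M ((f, r (mult M g h)), mult M g h)
      = ((s f, act M f (mult M g h)), mult M f (mult M g h))"
    by (rule alpha_eq) (use assms e in auto)
  have a2: "alpha M ((mult M f g, r h), h)
      = ((s f, act M (mult M f g) h), mult M (mult M f g) h)"
    by (subst alpha_eq) (use assms e in auto)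
  have a3: "alpha M ((act M f g, r h), act M (mult M f g) h)
      = ((r f, act M (act M f g) (act M (mult M f g) h)),
          mult M (act M f g) (act M (mult M f g) h))"
    using alpha_eq[of "act M f g" "act M (mult M f g) h"]
      assms e r_act[of "mult M f g" h] s_act[of "mult M f g" h] act_in[of "mult M f g" h] by auto
  from bspec[OF axiom1 z] show "mult M f (mult M g h) = mult M (mult M f g) h"
    "act M f (mult M g h) = mult M (act M f g) (act M (mult M f g) h)"
    "act M g h = act M (act M f g) (act M (mult M f g) h)"
    using assms a1 a2 a3 e by (simp_all add: cell_simps p_def legs)
qed

lemma act_unit:
  assumes "u \<in> U" "f \<in> E" "g \<in> E" "i u = s f" "t f = s g"
  shows "act M f g = g"
proof -
  have z: "((u, r f, r g), (f, r g), g) \<in> apex (p \<odot> p1 \<odot> j11)"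
    using assms leg_in by (auto simp: composite_simps legs)
  from bspec[OF axiom2 z] show ?thesis
    using assms alpha_eq[of f g] lam_eq[of u f] by (simp add: cell_simps p_def j_def legs)
qed

text \<open>The three components of axiom 3 have different roles: a unit law of the category, the
  preservation of identities by \<open>R\<close>, and a compatibility of \<open>\<psi>\<close> with \<open>r\<close> and \<open>t\<close> which amounts
  to \<open>e(t(f)) = e(r(f))\<close>.\<close>

lemma
  assumes "f \<in> E"
  shows phi_mult: "mult M f (phi M (t f)) = f"
    and act_phi: "act M f (phi M (t f)) = phi M (r f)"
    and psi_t: "psi M (t f) = psi M (r f)"
proof -
  have z: "f \<in> apex p"
    using assms by (simp add: p_def)
  from bspec[OF axiom3 z] show "mult M f (phi M (t f)) = f"
    "act M f (phi M (t f)) = phi M (r f)" "psi M (t f) = psi M (r f)"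
    using assms alpha_eq[of f "phi M (t f)"] leg_in[OF assms]
    by (simp_all add: cell_simps p_def j_def legs rho_eq phi_in s_phi i_psi)
qed

lemma mult_phi:
  assumes "f \<in> E"
  shows "mult M (phi M (s f)) f = f"
proof -
  have z: "f \<in> apex p"
    using assms by (simp add: p_def)
  from bspec[OF axiom4 z] show ?thesis
    using assms alpha_eq[of "phi M (s f)" f] leg_in[OF assms]
    by (simp add: cell_simps p_def legs rho_eq phi_in t_phi)
qed

lemma psi_i:
  assumes "u \<in> U"
  shows "psi M (i u) = u"
proof -
  have z: "u \<in> apex j"
    using assms by (simp add: j_def)
  from bspec[OF axiom5 z] show ?thesis
    using assms lam_eq[of u "phi M (i u)"] unit_leg_in[OF assms]
    by (simp add: cell_simps j_def rho_eq phi_in s_phi t_phi i_psi)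
qed

lemma induced_cat_simps [simp]:
  "Obj (induced_cat M C) = C" "Arr (induced_cat M C) = E" "Dom (induced_cat M C) = s"
  "Cod (induced_cat M C) = t" "Ident (induced_cat M C) = phi M"
  "Comp (induced_cat M C) g f = mult M f g"
  by (simp_all add: induced_cat_def)

lemma induced_functor_simps [simp]:
  "FObj (induced_functor M) (x, f) = r f" "FArr (induced_functor M) (x, f, g) = act M f g"
  by (simp_all add: induced_functor_def)

lemma category_induced: "category (induced_cat M C)"
  by unfold_locales
    (auto simp: leg_in phi_in s_phi t_phi mult_in s_mult t_mult mult_phi phi_mult mult_assoc)

lemma decalage_induced: "decalage_structure (induced_cat M C) (induced_functor M)"
proof -
  interpret A: category "induced_cat M C"
    by (rule category_induced)
  interpret D: category "Dec (induced_cat M C)"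
    by (rule A.category_Dec)
  have "cat_functor (Dec (induced_cat M C)) (induced_cat M C) (induced_functor M)"
    by unfold_locales (auto simp: Dec_simps leg_in act_in s_act t_act act_phi act_mult t_mult)
  \<comment> \<open>A fixed point \<open>x\<close> of \<open>e\<close> lies in the image of the unit leg, since \<open>x = r(\<phi>\<^sub>x) = i(\<psi>\<^sub>x)\<close>.\<close>
  moreover have "r f = t f" if "f \<in> E" "r (phi M (s f)) = s f" for f
    using r_eq_t[of "psi M (s f)" f] that by (simp add: psi_in i_psi leg_in)
  moreover have "act M f g = g" if "f \<in> E" "g \<in> E" "t f = s g" "r (phi M (s f)) = s f" for f g
    using act_unit[of "psi M (s f)" f g] that by (simp add: psi_in i_psi leg_in)
  ultimately show ?thesis
    by (auto simp: decalage_structure_iff r_act act_act)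
qed

end

section \<open>From decalage structures to skew monoidales\<close>

definition skew_of :: "('c, 'e) cat \<Rightarrow> ('c \<times> 'e, 'c \<times> 'e \<times> 'e, 'c, 'e) functor_data
    \<Rightarrow> ('c, 'e, 'c) skew_data" where
  "skew_of A R = \<lparr>
    tens = \<lparr>apex = Arr A, lleg = \<lambda>f. (Dom A f, FObj R (Dom A f, f)), rleg = Cod A\<rparr>,
    unt = \<lparr>apex = {x \<in> Obj A. FObj R (x, Ident A x) = x}, lleg = \<lambda>_. (), rleg = id\<rparr>,
    alpha = \<lambda>((f, c), g). ((Dom A f, FArr R (Dom A f, f, g)), Comp A g f),
    lam = \<lambda>((u, c), f). c,
    rho = \<lambda>x. ((x, FObj R (x, Ident A x)), Ident A x)\<rparr>"

context decalage_structure
begin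

text \<open>\<open>r\<close> and \<open>g\<^sup>f\<close> as functions of the arrows alone. They are kept opaque so that simplification
  of \<open>Dom A f\<close> does not destroy the arguments of \<open>R\<close>.\<close>

definition robj :: "'a \<Rightarrow> 'o" where "robj f = FObj R (Dom A f, f)"
definition rarr :: "'a \<Rightarrow> 'a \<Rightarrow> 'a" where "rarr f g = FArr R (Dom A f, f, g)"

lemma robj_in: "f \<in> Arr A \<Longrightarrow> robj f \<in> Obj A"
  using fobj[of "(Dom A f, f)"] by (simp add: robj_def Dec_simps B.dom_obj)

lemma
  assumes "f \<in> Arr A" "g \<in> Arr A" "Cod A f = Dom A g"
  shows rarr_in: "rarr f g \<in> Arr A" and dom_rarr: "Dom A (rarr f g) = robj f"
    and cod_rarr: "Cod A (rarr f g) = robj (Comp A g f)"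
    and robj_rarr: "robj (rarr f g) = robj g"
proof -
  have z: "(Dom A f, f, g) \<in> Arr (Dec A)"
    using assms by (simp add: Dec_simps B.dom_obj)
  show "rarr f g \<in> Arr A" and d: "Dom A (rarr f g) = robj f"
    and "Cod A (rarr f g) = robj (Comp A g f)"
    using farr[OF z] fdom[OF z] fcod[OF z] assms
    by (simp_all add: robj_def rarr_def Dec_simps B.dom_comp)
  have "FObj R (Cod A f, g) = FObj R (FObj R (Dom A f, f), FArr R (Dom A f, f, g))"
    using square assms unfolding B.square_iff by blast
  then show "robj (rarr f g) = robj g"
    using d assms by (simp add: robj_def rarr_def)
qed

lemma
  assumes "f \<in> Arr A" "g \<in> Arr A" "h \<in> Arr A" "Cod A f = Dom A g" "Cod A g = Dom A h"
  shows rarr_comp: "rarr f (Comp A h g) = Comp A (rarr (Comp A g f) h) (rarr f g)"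
    and rarr_rarr: "rarr (rarr f g) (rarr (Comp A g f) h) = rarr g h"
proof -
  have "(Dom A f, f, g) \<in> Arr (Dec A)" "(Dom A f, Comp A g f, h) \<in> Arr (Dec A)"
    using assms by (simp_all add: Dec_simps B.dom_obj B.comp_arr B.dom_comp B.cod_comp)
  then show "rarr f (Comp A h g) = Comp A (rarr (Comp A g f) h) (rarr f g)"
    using fcomp[of "(Dom A f, f, g)" "(Dom A f, Comp A g f, h)"] assms
    by (simp add: rarr_def Dec_simps B.dom_comp)
  have "FArr R (Cod A f, g, h) = FArr R (FObj R (Dom A f, f), FArr R (Dom A f, f, g),
          FArr R (Dom A f, Comp A g f, h))"
    using square assms unfolding B.square_iff by blast
  then show "rarr (rarr f g) (rarr (Comp A g f) h) = rarr g h"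
    using dom_rarr[of f g] assms by (simp add: robj_def rarr_def B.dom_comp)
qed

lemma rarr_ident:
  assumes "f \<in> Arr A"
  shows "rarr f (Ident A (Cod A f)) = Ident A (robj f)"
  using fident[of "(Dom A f, f)"] assms by (simp add: robj_def rarr_def Dec_simps B.dom_obj)

lemma
  assumes "f \<in> Arr A" "robj (Ident A (Dom A f)) = Dom A f"
  shows robj_normal: "robj f = Cod A f"
    and rarr_normal: "g \<in> Arr A \<Longrightarrow> Cod A f = Dom A g \<Longrightarrow> rarr f g = g"
proof -
  have e: "FObj R (Dom A f, Ident A (Dom A f)) = Dom A f"
    using assms by (simp add: robj_def B.dom_obj B.dom_ident)
  have "FObj R (Dom A f, f) = Cod A f
      \<and> (\<forall>g\<in>Arr A. Cod A f = Dom A g \<longrightarrow> FArr R (Dom A f, f, g) = g)"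
    using normal B.normal_iff[of R] assms(1) e by blast
  then show "robj f = Cod A f" "g \<in> Arr A \<Longrightarrow> Cod A f = Dom A g \<Longrightarrow> rarr f g = g"
    by (simp_all add: robj_def rarr_def)
qed

text \<open>This is \<open>e(r(f)) = e(t(f))\<close>, the square (b) at the object of \<open>Dec (Dec A)\<close> given by \<open>f\<close> and
  the identity of its codomain. It makes \<open>\<psi>\<close> satisfy axiom 3.\<close>

lemma robj_ident_cod:
  assumes "f \<in> Arr A"
  shows "robj (Ident A (robj f)) = robj (Ident A (Cod A f))"
  using robj_rarr[of f "Ident A (Cod A f)"] assms
  by (simp add: rarr_ident B.ident_arr B.dom_ident B.cod_obj)

lemma robj_idem:
  assumes "x \<in> Obj A"
  shows "robj (Ident A (robj (Ident A x))) = robj (Ident A x)"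
  using robj_ident_cod[of "Ident A x"] assms by (simp add: B.ident_arr B.cod_ident)

lemma skew_of_simps:
  "apex (tens (skew_of A R)) = Arr A"
  "lleg (tens (skew_of A R)) f = (Dom A f, robj f)"
  "rleg (tens (skew_of A R)) = Cod A"
  "apex (unt (skew_of A R)) = {x \<in> Obj A. robj (Ident A x) = x}"
  "lleg (unt (skew_of A R)) u = ()"
  "rleg (unt (skew_of A R)) = id"
  "alpha (skew_of A R) ((f, c), g) = ((Dom A f, rarr f g), Comp A g f)"
  "lam (skew_of A R) ((u, c), f) = c"
  "x \<in> Obj A \<Longrightarrow> rho (skew_of A R) x = ((x, robj (Ident A x)), Ident A x)"
  by (auto simp: skew_of_def robj_def rarr_def B.dom_ident)

lemma skew_monoidale_skew_of: "skew_monoidale (Obj A) (skew_of A R)"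
proof (unfold_locales, goal_cases)
  case 1
  then show ?case by (auto simp: is_span_def skew_of_simps B.dom_obj B.cod_obj robj_in)
next
  case 2
  then show ?case by (auto simp: is_span_def skew_of_simps)
next
  case 3
  then show ?case
    by (auto simp: two_cell_def span_simps skew_of_simps rarr_in dom_rarr cod_rarr robj_rarr
      B.dom_comp B.cod_comp B.comp_arr B.dom_obj)
next
  case 4
  then show ?case
    by (auto simp: two_cell_def span_simps skew_of_simps robj_normal)
next
  case 5
  then show ?case
    by (auto simp: two_cell_def span_simps skew_of_simps robj_in robj_idem B.ident_arr B.dom_ident
      B.cod_ident)
next
  case 6
  then show ?case
    by (auto simp: span_simps skew_of_simps cell_simps dom_rarr rarr_comp rarr_rarr B.comp_assoc)
next
  case 7
  then show ?case
    by (auto simp: span_simps skew_of_simps cell_simps rarr_normal)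
next
  case 8
  then show ?case
    by (auto simp: skew_of_simps cell_simps B.cod_obj robj_in robj_ident_cod rarr_ident B.ident_comp)
next
  case 9
  then show ?case
    by (auto simp: skew_of_simps cell_simps B.dom_obj B.comp_ident)
next
  case 10
  then show ?case
    by (auto simp: skew_of_simps cell_simps)
qed

end

lemma skew_of_induces:
  "induces (Obj A) (skew_of A R) A R"
  unfolding induces_def cat_eq_def functor_eq_def
  by (auto simp: induced_cat_def induced_functor_def Dec_simps s_of_def t_of_def r_of_def
      phi_def mult_def act_def skew_of_def)

section \<open>Uniqueness and the splitting of the unit idempotent\<close>

context skew_monoidale
begin

lemma induces_elements:
  assumes "induces C M A R"
  shows "Arr A = E" "\<And>f. f \<in> E \<Longrightarrow> s f = Dom A f" "\<And>f. f \<in> E \<Longrightarrow> t f = Cod A f"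
    "\<And>f. f \<in> E \<Longrightarrow> r f = FObj R (Dom A f, f)"
    "\<And>x. x \<in> C \<Longrightarrow> phi M x = Ident A x"
    "\<And>f g. f \<in> E \<Longrightarrow> g \<in> E \<Longrightarrow> t f = s g \<Longrightarrow> mult M f g = Comp A g f"
    "\<And>f g. f \<in> E \<Longrightarrow> g \<in> E \<Longrightarrow> t f = s g \<Longrightarrow> act M f g = FArr R (Dom A f, f, g)"
proof -
  have c: "cat_eq (induced_cat M C) A" and f: "functor_eq (Dec A) (induced_functor M) R"
    using assms by (simp_all add: induces_def)
  show arr: "Arr A = E" and dom: "\<And>f. f \<in> E \<Longrightarrow> s f = Dom A f"
    and cod: "\<And>f. f \<in> E \<Longrightarrow> t f = Cod A f"
    and "\<And>x. x \<in> C \<Longrightarrow> phi M x = Ident A x"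
    and "\<And>f g. f \<in> E \<Longrightarrow> g \<in> E \<Longrightarrow> t f = s g \<Longrightarrow> mult M f g = Comp A g f"
    using c by (auto simp: cat_eq_def)
  have obj: "Obj A = C"
    using c by (simp add: cat_eq_def)
  show "r f = FObj R (Dom A f, f)" if "f \<in> E" for f
  proof -
    have "(Dom A f, f) \<in> Obj (Dec A)"
      using that leg_in(1)[OF that] by (simp add: Dec_simps arr dom obj)
    then show ?thesis
      using f by (auto simp: functor_eq_def)
  qed
  show "act M f g = FArr R (Dom A f, f, g)" if "f \<in> E" "g \<in> E" "t f = s g" for f g
  proof -
    have "(Dom A f, f, g) \<in> Arr (Dec A)"
      using that leg_in(1)[of f] by (simp add: Dec_simps arr dom cod obj)
    then show ?thesis
      using f by (auto simp: functor_eq_def)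
  qed
qed

lemma i_psi_ident:
  assumes "induces C M A R" "x \<in> C"
  shows "i (psi M x) = FObj R (x, Ident A x)"
  using induces_elements(2,4)[OF assms(1) phi_in[OF assms(2)]] induces_elements(5)[OF assms] assms(2)
    s_phi[OF assms(2)]
  by (simp add: i_psi)

end

text \<open>The auxiliary spans are parameters of the locale \<open>skew_monoidale\<close>; instantiating them once
  here allows two structures to be considered side by side.\<close>

locale skew_structure =
  fixes C :: "'c set" and M :: "('c, 'e, 'u) skew_data"
  assumes skew_monoidale: "skew_monoidale C M"

sublocale skew_structure \<subseteq> skew_monoidale C M "tens M" "unt M"
  "reindex assoc_right (tens M \<boxtimes> id_span C)" "reindex assoc_right (tens M \<boxtimes> id_span (C \<times> C))"
  "id_span C \<boxtimes> tens M"
  "reindex snd (unt M \<boxtimes> id_span C)" "reindex snd (unt M \<boxtimes> id_span (C \<times> C))"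
  "reindex fst (id_span C \<boxtimes> unt M)"
  by (rule skew_monoidale) (rule reflexive)+

lemma unit_change_exists:
  fixes M :: "('c, 'e, 'u) skew_data" and N :: "('c, 'e, 'v) skew_data"
  assumes "skew_monoidale C M" "induces C M A R" "skew_monoidale C N" "induces C N A R"
  shows "\<exists>h. unit_change C M N h"
proof
  interpret M: skew_structure C M by (rule skew_structure.intro) fact
  interpret N: skew_structure C N by (rule skew_structure.intro) fact
  define h where "h u = psi N (M.i u)" for u
  define k where "k v = psi M (N.i v)" for v
  note m = M.induces_elements[OF assms(2)] and n = N.induces_elements[OF assms(4)]
  have E: "N.E = M.E"
    using m(1) n(1) by simp
  have s: "N.s f = M.s f" and t: "N.t f = M.t f" and r: "N.r f = M.r f" if "f \<in> M.E" for f
    using m n that E by auto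
  have i_psi: "M.i (psi M x) = N.i (psi N x)" if "x \<in> C" for x
    using M.i_psi_ident[OF assms(2) that] N.i_psi_ident[OF assms(4) that] by simp
  have h: "h u \<in> N.U" "N.i (h u) = M.i u" "k (h u) = u" if "u \<in> M.U" for u
    using that i_psi[OF M.unit_leg_in[OF that]]
    by (simp_all add: h_def k_def N.psi_in M.unit_leg_in M.psi_i)
  have k: "k v \<in> M.U" "h (k v) = v" if "v \<in> N.U" for v
    using that i_psi[OF N.unit_leg_in[OF that]]
    by (simp_all add: h_def k_def M.psi_in N.unit_leg_in N.psi_i)
  have h_psi: "h (psi M x) = psi N x" if "x \<in> C" for x
    using that by (simp add: h_def i_psi N.psi_i N.psi_in)
  show "unit_change C M N h"
    unfolding unit_change_def
  proof (intro conjI)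
    show "two_cell (unt M) (unt N) h"
      using h by (auto simp: two_cell_def)
    show "bij_betw h M.U N.U"
      by (rule bij_betwI[where g = k]) (use h k in auto)
    show "span_eq (tens M) (tens N)"
      using E s t r by (simp add: span_eq_def M.legs N.legs)
    show "\<forall>z\<in>apex (tens M \<odot> reindex assoc_right (tens M \<boxtimes> id_span C)). alpha N z = alpha M z"
    proof
      fix z assume "z \<in> apex (tens M \<odot> reindex assoc_right (tens M \<boxtimes> id_span C))"
      then obtain f g where z: "z = ((f, M.r g), g)" and fg: "f \<in> M.E" "g \<in> M.E" "M.t f = M.s g"
        by (auto simp: span_simps M.legs)
      then show "alpha N z = alpha M z"
        using M.alpha_eq[OF fg] N.alpha_eq[of f g] m(6,7)[of f g] n(6,7)[of f g] s t r E by simp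
    qed
    show "\<forall>z\<in>apex (tens M \<odot> reindex snd (unt M \<boxtimes> id_span C)).
        lam N (lwhisk (tensor_one h) z) = lam M z"
    proof
      fix z assume "z \<in> apex (tens M \<odot> reindex snd (unt M \<boxtimes> id_span C))"
      then obtain u f where z: "z = ((u, M.r f), f)" and uf: "u \<in> M.U" "f \<in> M.E" "M.i u = M.s f"
        by (auto simp: span_simps M.legs)
      then show "lam N (lwhisk (tensor_one h) z) = lam M z"
        using M.lam_eq[OF uf] N.lam_eq[of "h u" f] h s t r E by (simp add: lwhisk_def tensor_one_def)
    qed
    show "\<forall>x\<in>C. rho N x = lwhisk (one_tensor h) (rho M x)"
      using m(5) n(5) by (simp add: M.rho_eq N.rho_eq h_psi lwhisk_def one_tensor_def)
  qed
qed

text \<open>Idempotence of \<open>e\<close> follows from the splitting: \<open>j \<psi> j \<psi> = j \<psi>\<close> as \<open>\<psi> j = 1\<close>.\<close>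

lemma unit_splitting:
  assumes "skew_monoidale C M" "induces C M A R"
    and e: "e = (\<lambda>x. FObj R (x, Ident A x))"
  shows "e \<in> C \<rightarrow> C" "\<forall>x\<in>C. e (e x) = e x" "rleg (unt M) \<in> apex (unt M) \<rightarrow> C"
    "psi M \<in> C \<rightarrow> apex (unt M)" "\<forall>u\<in>apex (unt M). psi M (rleg (unt M) u) = u"
    "\<forall>x\<in>C. rleg (unt M) (psi M x) = e x"
proof -
  interpret skew_structure C M
    by (rule skew_structure.intro) fact
  have i_psi: "i (psi M x) = e x" if "x \<in> C" for x
    using i_psi_ident[OF assms(2) that] e by simp
  show e_in: "e \<in> C \<rightarrow> C"
    using i_psi unit_leg_in psi_in by fastforce
  show "\<forall>x\<in>C. rleg (unt M) (psi M x) = e x"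
    using i_psi by blast
  show "\<forall>u\<in>apex (unt M). psi M (rleg (unt M) u) = u"
    using psi_i by blast
  show "rleg (unt M) \<in> apex (unt M) \<rightarrow> C" "psi M \<in> C \<rightarrow> apex (unt M)"
    using unit_leg_in psi_in by blast+
  show "\<forall>x\<in>C. e (e x) = e x"
    using i_psi psi_i psi_in e_in by (metis PiE)
qed

theorem mainTheorem1:
  fixes C :: "'c set"
  shows
    "(\<forall>M :: ('c, 'e, 'u) skew_data.
        skew_monoidale C M \<longrightarrow>
          category (induced_cat M C)
          \<and> decalage_structure (induced_cat M C) (induced_functor M))
     \<and>
     (\<forall>(A :: ('c, 'e) cat) R.
        category A \<and> Obj A = C \<and> decalage_structure A R \<longrightarrow>
          (\<exists>M :: ('c, 'e, 'c) skew_data. skew_monoidale C M \<and> induces C M A R)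
          \<and>
          (\<forall>(M :: ('c, 'e, 'u) skew_data) (N :: ('c, 'e, 'v) skew_data).
              skew_monoidale C M \<and> induces C M A R \<and> skew_monoidale C N \<and> induces C N A R \<longrightarrow>
                (\<exists>h. unit_change C M N h))
          \<and>
          (\<forall>M :: ('c, 'e, 'u) skew_data.
              skew_monoidale C M \<and> induces C M A R \<longrightarrow>
                (let U = apex (unt M); j = rleg (unt M); e = (\<lambda>x. FObj R (x, Ident A x)) in
                  e \<in> C \<rightarrow> C \<and> (\<forall>x\<in>C. e (e x) = e x)
                  \<and> j \<in> U \<rightarrow> C \<and> psi M \<in> C \<rightarrow> U
                  \<and> (\<forall>u\<in>U. psi M (j u) = u) \<and> (\<forall>x\<in>C. j (psi M x) = e x))))"
proof (intro conjI allI impI)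
  fix M :: "('c, 'e, 'u) skew_data"
  assume "skew_monoidale C M"
  then interpret skew_structure C M
    by (rule skew_structure.intro)
  show "category (induced_cat M C)" "decalage_structure (induced_cat M C) (induced_functor M)"
    by (rule category_induced decalage_induced)+
next
  fix A :: "('c, 'e) cat" and R
  assume "category A \<and> Obj A = C \<and> decalage_structure A R"
  then show "\<exists>M :: ('c, 'e, 'c) skew_data. skew_monoidale C M \<and> induces C M A R"
    using decalage_structure.skew_monoidale_skew_of skew_of_induces by blast
next
  fix A :: "('c, 'e) cat" and R
    and M :: "('c, 'e, 'u) skew_data" and N :: "('c, 'e, 'v) skew_data"
  assume "skew_monoidale C M \<and> induces C M A R \<and> skew_monoidale C N \<and> induces C N A R"
  then show "\<exists>h. unit_change C M N h"
    using unit_change_exists by blast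
next
  fix A :: "('c, 'e) cat" and R and M :: "('c, 'e, 'u) skew_data"
  assume "skew_monoidale C M \<and> induces C M A R"
  then have M: "skew_monoidale C M" "induces C M A R"
    by auto
  show "let U = apex (unt M); j = rleg (unt M); e = (\<lambda>x. FObj R (x, Ident A x)) in
      e \<in> C \<rightarrow> C \<and> (\<forall>x\<in>C. e (e x) = e x)
      \<and> j \<in> U \<rightarrow> C \<and> psi M \<in> C \<rightarrow> U
      \<and> (\<forall>u\<in>U. psi M (j u) = u) \<and> (\<forall>x\<in>C. j (psi M x) = e x)"
    unfolding Let_def by (intro conjI unit_splitting[OF M refl])
qed

end
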